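(* Let $n\ge 1$ and let $G$ be a non-abelian subgroup of $\mathcal{S}_n$. Then the following assertions are equivalent: (i) $G$ has a dense orbit in $\mathbb{R}^n$; (ii) every orbit of $G$ is dense in $\mathbb{R}^n$; (iii) the orbit $G(0)$ is dense in $\mathbb{R}^n$; (iv) $H_G$ is dense in $\mathbb{R}^n$.
   Context: $\mathcal{S}_n$ is the group (under composition) of all maps $x\mapsto\varepsilon x+a$ of $\mathbb{R}^n$ with $\varepsilon\in\{-1,1\}$ and $a\in\mathbb{R}^n$. $\mathcal{T}_n$ is the group of all translations of $\mathbb{R}^n$. For $v\in\mathbb{R}^n$, $G(v)=\{f(v):f\in G\}$ is the orbit of $v$. $G_1=G\cap\mathcal{T}_n$ and $H_G=G_1(0)=\{f(0):f\in G_1\}$, an additive subgroup of $\mathbb{R}^n$. *)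

theory Defs
  imports "HOL-Analysis.Analysis" "HOL-Algebra.Group"
begin

definition S_maps :: "((real ^ 'n) \<Rightarrow> (real ^ 'n)) set"
  where "S_maps = {f. \<exists>\<epsilon>\<in>{-1, 1::real}. \<exists>a. f = (\<lambda>x. \<epsilon> *\<^sub>R x + a)}"

definition S_group :: "((real ^ 'n) \<Rightarrow> (real ^ 'n)) monoid"
  where "S_group = \<lparr>carrier = S_maps, monoid.mult = (\<circ>), one = id\<rparr>"

definition T_maps :: "((real ^ 'n) \<Rightarrow> (real ^ 'n)) set"
  where "T_maps = {f. \<exists>a. f = (\<lambda>x. x + a)}"

definition orbit_of :: "('a \<Rightarrow> 'a) set \<Rightarrow> 'a \<Rightarrow> 'a set"
  where "orbit_of G v = {f v | f. f \<in> G}"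

definition translation_part ::
    "((real ^ 'n) \<Rightarrow> (real ^ 'n)) set \<Rightarrow> ((real ^ 'n) \<Rightarrow> (real ^ 'n)) set"
  where "translation_part G = G \<inter> T_maps"

definition H_of :: "((real ^ 'n) \<Rightarrow> (real ^ 'n)) set \<Rightarrow> (real ^ 'n) set"
  where "H_of G = orbit_of (translation_part G) 0"

definition dense_set :: "'a::topological_space set \<Rightarrow> bool"
  where "dense_set X \<longleftrightarrow> closure X = UNIV"

lemma S_mapsI: "\<epsilon> \<in> {-1, 1::real} \<Longrightarrow> f = (\<lambda>x. \<epsilon> *\<^sub>R x + a) \<Longrightarrow> f \<in> S_maps"
  unfolding S_maps_def by blast

lemma S_mapsE:
  assumes "f \<in> S_maps"
  obtains \<epsilon> :: real and a where "\<epsilon> \<in> {-1, 1}" "f = (\<lambda>x. \<epsilon> *\<^sub>R x + a)"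
  using assms unfolding S_maps_def by blast

lemma S_group_simps [simp]:
  "carrier S_group = S_maps" "f \<otimes>\<^bsub>S_group\<^esub> g = f \<circ> g" "\<one>\<^bsub>S_group\<^esub> = id"
  by (simp_all add: S_group_def)

lemma S_group_is_group: "group (S_group :: ((real ^ 'n) \<Rightarrow> (real ^ 'n)) monoid)"
proof (rule groupI, unfold S_group_simps)
  fix f g :: "(real ^ 'n) \<Rightarrow> (real ^ 'n)"
  assume "f \<in> S_maps" "g \<in> S_maps"
  then obtain d e a b where d: "d \<in> {-1, 1::real}" and e: "e \<in> {-1, 1::real}"
    and f: "f = (\<lambda>x. d *\<^sub>R x + a)" and g: "g = (\<lambda>x. e *\<^sub>R x + b)"
    by (metis S_mapsE)
  have "f \<circ> g = (\<lambda>x. (d * e) *\<^sub>R x + (d *\<^sub>R b + a))"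
    by (simp add: f g fun_eq_iff scaleR_add_right)
  moreover have "d * e \<in> {-1, 1::real}" using d e by auto
  ultimately show "f \<circ> g \<in> S_maps" by (rule S_mapsI[rotated])
next
  show "id \<in> (S_maps :: ((real ^ 'n) \<Rightarrow> (real ^ 'n)) set)"
    by (rule S_mapsI[of 1 _ 0]) auto
next
  fix f :: "(real ^ 'n) \<Rightarrow> (real ^ 'n)"
  assume "f \<in> S_maps"
  then obtain d a where d: "d \<in> {-1, 1::real}" and f: "f = (\<lambda>x. d *\<^sub>R x + a)"
    by (rule S_mapsE)
  let ?g = "\<lambda>x. d *\<^sub>R x + (- d) *\<^sub>R a"
  have "?g \<circ> f = id" using d by (auto simp: f fun_eq_iff)
  moreover have "?g \<in> S_maps" using d by (rule S_mapsI) (rule refl)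
  ultimately show "\<exists>g\<in>S_maps. g \<circ> f = id" by blast
qed (auto simp: comp_assoc)

end

theory Submission
  imports Defs
begin

text \<open>
  A non-abelian \<open>G\<close> contains a point reflection \<open>x \<mapsto> c - x\<close>, so the orbit of \<open>v\<close> is the union of
  the two cosets \<open>v + H\<close> and \<open>c - v + H\<close> of \<open>H = H_G\<close>. If that orbit is dense, the corresponding
  two cosets of the closed subgroup \<open>closure H\<close> cover the space; as the space is connected, they
  cannot be disjoint, hence they coincide and \<open>closure H\<close> is everything.
\<close>

text \<open>Subtraction is continuous, so differences of approximating sequences in \<open>H\<close>
  approximate the difference of the limits.\<close>

lemma closure_diff_closed:
  fixes H :: "'a::real_normed_vector set"
  assumes diff: "\<And>a b. a \<in> H \<Longrightarrow> b \<in> H \<Longrightarrow> a - b \<in> H"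
    and "x \<in> closure H" "y \<in> closure H"
  shows "x - y \<in> closure H"
proof -
  obtain a b where "\<And>n. a n \<in> H" "a \<longlonglongrightarrow> x" "\<And>n. b n \<in> H" "b \<longlonglongrightarrow> y"
    using assms(2,3) unfolding closure_sequential by blast
  then have "\<And>n::nat. a n - b n \<in> H" "(\<lambda>n. a n - b n) \<longlonglongrightarrow> x - y"
    by (auto intro: diff tendsto_diff)
  then show ?thesis
    unfolding closure_sequential by (intro exI[of _ "\<lambda>n. a n - b n"]) blast
qed

lemma dense_union_two_cosets:
  fixes H :: "'a::real_normed_vector set"
  assumes ne: "H \<noteq> {}"
    and diff: "\<And>a b. a \<in> H \<Longrightarrow> b \<in> H \<Longrightarrow> a - b \<in> H"
    and dense: "closure ((+) u ` H \<union> (+) w ` H) = UNIV"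
  shows "closure H = UNIV"
proof -
  let ?K = "closure H"
  have K_diff: "x - y \<in> ?K" if "x \<in> ?K" "y \<in> ?K" for x y
    using closure_diff_closed[of H x y] diff that by blast
  \<comment> \<open>Differences alone give the subgroup structure: 0 is \<open>h - h\<close> for
    some \<open>h\<close> in \<open>H\<close>, and below \<open>x + y\<close> is
    \<open>x - (0 - y)\<close>.\<close>
  have K_0: "0 \<in> ?K"
    using ne K_diff closure_subset[of H] by force
  have K_add: "x + y \<in> ?K" if "x \<in> ?K" "y \<in> ?K" for x y
    using K_diff[OF that(1) K_diff[OF K_0 that(2)]] by simp
  \<comment> \<open>Closure commutes with finite unions and with translations.\<close>
  have cover: "(+) u ` ?K \<union> (+) w ` ?K = UNIV"
    using dense by (simp add: closure_translation)
  have "(+) u ` ?K \<inter> (+) w ` ?K \<noteq> {}"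
  proof
    assume "(+) u ` ?K \<inter> (+) w ` ?K = {}"
    moreover have "closed ((+) u ` ?K)" "closed ((+) w ` ?K)"
      by (simp_all add: closed_translation)
    ultimately have "(+) u ` ?K = {} \<or> (+) w ` ?K = {}"
      using cover connected_closedD[OF connected_UNIV, of "(+) u ` ?K" "(+) w ` ?K"] by simp
    then show False using ne by simp
  qed
  \<comment> \<open>A common point forces \<open>w - u\<close> into the subgroup \<open>?K\<close>,
    so the two cosets are the same.\<close>
  then obtain k l where kl: "k \<in> ?K" "l \<in> ?K" "u + k = w + l" by auto
  have "w - u = k - l"
    using kl(3) by (simp add: algebra_simps)
  then have wu: "w - u \<in> ?K"
    using K_diff[OF kl(1,2)] by simp
  \<comment> \<open>Apply the cover to \<open>u + x\<close> rather than \<open>x\<close>: lying in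
    the coset of \<open>u\<close> then means \<open>x \<in> ?K\<close>.\<close>
  have "x \<in> ?K" for x
  proof -
    consider m where "m \<in> ?K" "u + x = u + m" | m where "m \<in> ?K" "u + x = w + m"
      using cover by blast
    then show ?thesis
    proof cases
      case (2 m)
      then have "x = (w - u) + m" by (simp add: algebra_simps)
      then show ?thesis using K_add[OF wu \<open>m \<in> ?K\<close>] by simp
    qed simp
  qed
  then show ?thesis by auto
qed

text \<open>A translation is determined by its value at 0, so questions about \<open>H_of G\<close>
  become questions about composing maps in \<open>G\<close>.\<close>

lemma mem_H_of_iff: "a \<in> H_of G \<longleftrightarrow> (\<lambda>x. x + a) \<in> G"
proof
  assume "a \<in> H_of G"
  then show "(\<lambda>x. x + a) \<in> G"
    unfolding H_of_def orbit_of_def translation_part_def T_maps_def by auto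
next
  assume "(\<lambda>x. x + a) \<in> G"
  then have "(\<lambda>x. x + a) \<in> translation_part G"
    unfolding translation_part_def T_maps_def by blast
  then show "a \<in> H_of G"
    unfolding H_of_def orbit_of_def by (auto intro!: exI[of _ "\<lambda>x. x + a"])
qed

lemma S_maps_cases:
  assumes "f \<in> S_maps"
  obtains (translation) a where "f = (\<lambda>x. x + a)" | (reflection) c where "f = (\<lambda>x. c - x)"
  using assms by (elim S_mapsE) auto

text \<open>Without a reflection \<open>G\<close> would consist of translations only, and these
  commute.\<close>

lemma nonabelian_has_reflection:
  fixes G :: "((real ^ 'n) \<Rightarrow> (real ^ 'n)) set"
  assumes sub: "subgroup G S_group"
    and nonabelian: "\<not> comm_group (S_group\<lparr>carrier := G\<rparr>)"
  obtains c where "(\<lambda>x. c - x) \<in> G"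
proof (rule ccontr)
  assume "\<not> thesis"
  then have no_refl: "(\<lambda>x. c - x) \<notin> G" for c using that by blast
  have trans: "\<exists>a. f = (\<lambda>x. x + a)" if "f \<in> G" for f
  proof -
    have "f \<in> S_maps" using that subgroup.subset[OF sub] by auto
    then show ?thesis
      by (cases rule: S_maps_cases) (use that no_refl in auto)
  qed
  have "group (S_group\<lparr>carrier := G\<rparr>)"
    by (rule subgroup.subgroup_is_group[OF sub S_group_is_group])
  then have "comm_group (S_group\<lparr>carrier := G\<rparr>)"
  proof (rule group.group_comm_groupI)
    fix f g assume "f \<in> carrier (S_group\<lparr>carrier := G\<rparr>)" "g \<in> carrier (S_group\<lparr>carrier := G\<rparr>)"
    then obtain a b where "f = (\<lambda>x. x + a)" "g = (\<lambda>x. x + b)"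
      using trans by fastforce
    then show "f \<otimes>\<^bsub>S_group\<lparr>carrier := G\<rparr>\<^esub> g = g \<otimes>\<^bsub>S_group\<lparr>carrier := G\<rparr>\<^esub> f"
      by (simp add: fun_eq_iff algebra_simps)
  qed
  then show False using nonabelian by blast
qed

lemma zero_mem_H_of: "subgroup G S_group \<Longrightarrow> 0 \<in> H_of G"
  using subgroup.one_closed[of G S_group] by (simp add: mem_H_of_iff id_def)

lemma H_of_diff:
  assumes sub: "subgroup G S_group" and refl: "(\<lambda>x. c - x) \<in> G"
    and a: "a \<in> H_of G" and b: "b \<in> H_of G"
  shows "a - b \<in> H_of G"
proof -
  have comp: "f \<circ> g \<in> G" if "f \<in> G" "g \<in> G" for f g
    using subgroup.m_closed[OF sub that] by simp
  \<comment> \<open>Conjugating a translation by the reflection inverts it.\<close>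
  have "(\<lambda>x. x + a) \<circ> ((\<lambda>x. c - x) \<circ> ((\<lambda>x. x + b) \<circ> (\<lambda>x. c - x))) \<in> G"
    using a b refl by (intro comp) (simp_all add: mem_H_of_iff)
  also have "(\<lambda>x. x + a) \<circ> ((\<lambda>x. c - x) \<circ> ((\<lambda>x. x + b) \<circ> (\<lambda>x. c - x))) = (\<lambda>x. x + (a - b))"
    by (simp add: fun_eq_iff)
  finally show ?thesis by (simp add: mem_H_of_iff)
qed

text \<open>The product of two reflections is a translation, so each element of \<open>G\<close> is
  a translation in \<open>G\<close>, possibly preceded by the fixed reflection
  \<open>x \<mapsto> c - x\<close>. These two types send \<open>v\<close> into the two
  cosets.\<close>

lemma orbit_eq_two_cosets:
  assumes sub: "subgroup G S_group" and refl: "(\<lambda>x. c - x) \<in> G"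
  shows "orbit_of G v = (+) v ` H_of G \<union> (+) (c - v) ` H_of G"
proof (intro equalityI subsetI)
  have comp: "f \<circ> g \<in> G" if "f \<in> G" "g \<in> G" for f g
    using subgroup.m_closed[OF sub that] by simp
  {
    fix y assume "y \<in> orbit_of G v"
    then obtain f where f: "f \<in> G" "y = f v" unfolding orbit_of_def by blast
    then have "f \<in> S_maps" using subgroup.subset[OF sub] by auto
    then show "y \<in> (+) v ` H_of G \<union> (+) (c - v) ` H_of G"
    proof (cases rule: S_maps_cases)
      case (translation a)
      then show ?thesis using f by (auto simp: mem_H_of_iff)
    next
      case (reflection d)
      \<comment> \<open>Reflecting first in the fixed reflection turns \<open>f\<close> into a
        translation, which measures how far \<open>d\<close> is from \<open>c\<close> modulo
        \<open>H_of G\<close>.\<close>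
      have "f \<circ> (\<lambda>x. c - x) = (\<lambda>x. x + (d - c))"
        by (simp add: reflection fun_eq_iff)
      then have "d - c \<in> H_of G"
        using comp[OF f(1) refl] by (simp add: mem_H_of_iff)
      moreover have "y = (c - v) + (d - c)" by (simp add: f(2) reflection)
      ultimately show ?thesis by blast
    qed
  next
    fix y assume "y \<in> (+) v ` H_of G \<union> (+) (c - v) ` H_of G"
    then obtain a where a: "(\<lambda>x. x + a) \<in> G" and y: "y = v + a \<or> y = (c - v) + a"
      by (auto simp: mem_H_of_iff)
    from y show "y \<in> orbit_of G v"
    proof
      assume "y = v + a"
      then show ?thesis
        unfolding orbit_of_def using a by (intro CollectI exI[of _ "\<lambda>x. x + a"]) simp
    next
      assume "y = (c - v) + a"
      then show ?thesis
        unfolding orbit_of_def using comp[OF a refl]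
        by (intro CollectI exI[of _ "(\<lambda>x. x + a) \<circ> (\<lambda>x. c - x)"]) simp
    qed
  }
qed

theorem corollary1p6:
  fixes G :: "((real ^ 'n) \<Rightarrow> (real ^ 'n)) set"
  assumes "subgroup G S_group"
    and "\<not> comm_group (S_group\<lparr>carrier := G\<rparr>)"
  shows "((\<exists>v. dense_set (orbit_of G v)) \<longleftrightarrow> (\<forall>v. dense_set (orbit_of G v)))
    \<and> ((\<forall>v. dense_set (orbit_of G v)) \<longleftrightarrow> dense_set (orbit_of G 0))
    \<and> (dense_set (orbit_of G 0) \<longleftrightarrow> dense_set (H_of G))"
proof -
  obtain c where refl: "(\<lambda>x. c - x) \<in> G"
    using nonabelian_has_reflection[OF assms] .
  note orbit = orbit_eq_two_cosets[OF assms(1) refl]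
  \<comment> \<open>The right-hand side is independent of \<open>v\<close>, so all the claimed
    equivalences follow at once.\<close>
  have "dense_set (orbit_of G v) \<longleftrightarrow> dense_set (H_of G)" for v
  proof
    assume "dense_set (orbit_of G v)"
    moreover have "H_of G \<noteq> {}"
      using zero_mem_H_of[OF assms(1)] by blast
    ultimately show "dense_set (H_of G)"
      unfolding dense_set_def orbit
      using dense_union_two_cosets H_of_diff[OF assms(1) refl] by blast
  next
    assume "dense_set (H_of G)"
    \<comment> \<open>A translate of a dense set is dense, so each of the two cosets is already
      dense.\<close>
    then show "dense_set (orbit_of G v)"
      unfolding dense_set_def orbit by (simp add: closure_translation)
  qed
  then show ?thesis by simp
qed

end
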